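(* For every positive integer $d$ and every $n \in \{d, \dots, \lfloor 3d/2 \rfloor\}$, \[ C(\mathbb{R}^d, n) = \sqrt{2n-d}. \]
   Context: For positive integers $n$ and $d$, $C(\mathbb{R}^d,n)$ denotes the largest constant $C$ such that for every $n$ unit vectors $v_1, \dots, v_n$ in $\mathbb{R}^d$ (with the Euclidean norm $\lVert\cdot\rVert$, and not necessarily distinct), there exist signs $\varepsilon_1, \dots, \varepsilon_n \in \{\pm 1\}$ such that $\lVert \varepsilon_1 v_1 + \dots + \varepsilon_n v_n \rVert \ge C$. Equivalently, $C(\mathbb{R}^d,n)$ is the minimum over all $n$-tuples of unit vectors $(v_1,\dots,v_n)$ in $\mathbb{R}^d$ of $\max_{\varepsilon \in \{\pm 1\}^n} \lVert \varepsilon_1 v_1 + \dots + \varepsilon_n v_n \rVert$. *)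

theory Defs
  imports "HOL-Analysis.Analysis"
begin

definition sign_sum_bound :: "'a::real_normed_vector itself \<Rightarrow> nat \<Rightarrow> real \<Rightarrow> bool" where
  "sign_sum_bound X n c \<longleftrightarrow>
     (\<forall>v :: nat \<Rightarrow> 'a. (\<forall>i<n. norm (v i) = 1) \<longrightarrow>
        (\<exists>\<epsilon> :: nat \<Rightarrow> real. (\<forall>i<n. \<epsilon> i \<in> {1, -1}) \<and>
           c \<le> norm (\<Sum>i<n. \<epsilon> i *\<^sub>R v i)))"

(* GREATEST rather than Sup: the constant is required to be attained. If there were no
   largest constant, the value would be unspecified. *)
definition sign_sum_const :: "'a::real_normed_vector itself \<Rightarrow> nat \<Rightarrow> real" where
  "sign_sum_const X n = (GREATEST c. sign_sum_bound X n c)"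

end

theory Submission
  imports Defs
begin

text \<open>
  Write \<open>d\<close> for the dimension and \<open>r = n - d\<close>.

  \<^bold>\<open>Upper bound.\<close> Three unit vectors of a plane at mutual angles of 120 degrees have signed sums
  of norm at most 2. Taking such a triple in each of \<open>r\<close> mutually orthogonal planes, which needs
  \<open>2 * r \<le> d\<close>, and an orthonormal basis of the remaining \<open>d - 2 * r\<close> dimensions gives \<open>n\<close> vectors
  whose signed sums have squared norm at most \<open>4 * r + (d - 2 * r) = 2 * n - d\<close>.

  \<^bold>\<open>Lower bound.\<close> For every \<open>n\<close> unit vectors some signed sum has squared norm at least
  \<open>2 * n - d\<close>. For coefficients \<open>y\<close> in the cube \<open>[-1, 1]^n\<close> consider
  \<open>norm (\<Sum> y i v i)^2 + \<Sum> (1 - (y i)^2)\<close>. The vectors are units, so the squares of the \<open>y i\<close>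
  cancel and the expression is affine in each coordinate; it can therefore be rounded to signs without
  loss (\<open>round_to_signs\<close>). So a point of the cube with
  \<open>norm (\<Sum> y i v i)^2 - \<Sum> (y i)^2 \<ge> n - d\<close> is sufficient. Only points
  \<open>y i = v i \<bullet> x\<close> with \<open>x\<close> in the space are used; with the frame operator
  \<open>S x = \<Sum> (v i \<bullet> x) v i\<close> the quantity to be made large is then \<open>S x \<bullet> S x - x \<bullet> S x\<close>.

  Let \<open>l 0 \<ge> l 1 \<ge> \<dots>\<close> be the eigenvalues of \<open>S\<close>, with orthonormal eigenvectors \<open>e j\<close>. Their sum is
  \<open>n\<close>, so the sum of the \<open>l j - 1\<close> is \<open>n - d\<close>. The point \<open>x\<close> is built by a walk from 0 which at
  time \<open>k\<close> lies in the span of the first \<open>k\<close> eigenvectors and has at least \<open>k\<close> coordinates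
  equal to 1 or -1. In the next step, by counting dimensions, there is a direction \<open>z \<noteq> 0\<close> in the span
  of \<open>e 0, \<dots>, e k\<close> that changes none of these coordinates, and the walk follows it until it hits the
  boundary of the cube again. On this span \<open>S z \<bullet> S z \<ge> l k * (z \<bullet> S z)\<close>, so
  \<open>S x \<bullet> S x - l k * (x \<bullet> S x)\<close> is convex along the line and does not decrease in one of its two
  directions. Hence each step gains at least \<open>l k - 1\<close> times the growth of \<open>\<Sum> (y i)^2\<close>, which is
  at least \<open>k\<close> at time \<open>k\<close>, and summation by parts gives a total gain of at least
  \<open>\<Sum> (l j - 1)\<close> (\<open>eigenspace_walk\<close>). Stopping when the eigenvalues drop below 1 discards only
  negative terms, so the gain is at least \<open>n - d\<close> (\<open>exists_large_sign_sum\<close>).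
\<close>

section \<open>Orthonormal families and the spectral theorem\<close>

definition orthonormal_family :: "(nat \<Rightarrow> 'a::real_inner) \<Rightarrow> nat \<Rightarrow> bool" where
  "orthonormal_family e d \<longleftrightarrow> (\<forall>i<d. \<forall>j<d. e i \<bullet> e j = (if i = j then 1 else 0))"

lemma orthonormal_familyD:
  assumes "orthonormal_family e d" "i < d" "j < d"
  shows "e i \<bullet> e j = (if i = j then 1 else 0)"
  using assms unfolding orthonormal_family_def by blast

lemma orthonormal_family_expand:
  fixes e :: "nat \<Rightarrow> 'a::euclidean_space"
  assumes on: "orthonormal_family e DIM('a)"
  shows "(\<Sum>j<DIM('a). (x \<bullet> e j) *\<^sub>R e j) = x"
proof -
  let ?d = "DIM('a)"
  have inj: "inj_on e {..<?d}"
  proof (rule inj_onI)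
    fix i j assume "i \<in> {..<?d}" "j \<in> {..<?d}" "e i = e j"
    then show "i = j"
      using orthonormal_familyD[OF on, of i j] orthonormal_familyD[OF on, of j j]
      by (auto split: if_splits)
  qed
  let ?B = "e ` {..<?d}"
  have orth: "pairwise orthogonal ?B"
    using orthonormal_familyD[OF on] by (auto simp: pairwise_def orthogonal_def)
  have nrm: "norm b = 1" if "b \<in> ?B" for b
    using that orthonormal_familyD[OF on] by (auto simp: norm_eq_1)
  have "independent ?B"
    using orth nrm by (intro pairwise_orthogonal_independent) force+
  moreover have "card ?B = ?d"
    using inj by (simp add: card_image)
  ultimately have "UNIV \<subseteq> span ?B"
    by (intro card_ge_dim_independent) auto
  then have "(\<Sum>b\<in>?B. (x \<bullet> b) *\<^sub>R b) = x"
    using orth nrm by (intro orthonormal_basis_expand) auto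
  then show ?thesis
    using inj by (simp add: sum.reindex)
qed

lemma orthonormal_family_inner:
  fixes e :: "nat \<Rightarrow> 'a::euclidean_space"
  assumes on: "orthonormal_family e DIM('a)"
  shows "x \<bullet> y = (\<Sum>j<DIM('a). (x \<bullet> e j) * (y \<bullet> e j))"
proof -
  have "x \<bullet> y = (\<Sum>j<DIM('a). (x \<bullet> e j) *\<^sub>R e j) \<bullet> y"
    by (simp only: orthonormal_family_expand[OF on])
  also have "\<dots> = (\<Sum>j<DIM('a). (x \<bullet> e j) * (e j \<bullet> y))"
    by (simp only: inner_sum_left inner_scaleR_left)
  also have "\<dots> = (\<Sum>j<DIM('a). (x \<bullet> e j) * (y \<bullet> e j))"
    by (simp only: inner_commute[of y])
  finally show ?thesis .
qed

lemma exists_common_orthogonal: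
  fixes f :: "'i \<Rightarrow> 'a::euclidean_space" and g :: "'j \<Rightarrow> 'a"
  assumes "finite A" "finite B" "card A + card B < DIM('a)"
  obtains x where "x \<noteq> 0" "\<And>i. i \<in> A \<Longrightarrow> f i \<bullet> x = 0" "\<And>j. j \<in> B \<Longrightarrow> g j \<bullet> x = 0"
proof -
  let ?T = "f ` A \<union> g ` B"
  have "dim ?T \<le> card ?T"
    using assms by (intro dim_le_card') auto
  also have "\<dots> \<le> card (f ` A) + card (g ` B)"
    by (rule card_Un_le)
  also have "\<dots> \<le> card A + card B"
    using assms by (intro add_mono card_image_le)
  finally have "dim ?T < DIM('a)"
    using assms by simp
  then obtain x where "x \<noteq> 0" and x: "\<And>y. y \<in> span ?T \<Longrightarrow> orthogonal x y"
    using orthogonal_to_subspace_exists by blast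
  have "y \<bullet> x = 0" if "y \<in> ?T" for y
    using x[OF span_base[OF that]] by (simp add: orthogonal_def inner_commute)
  then show ?thesis
    using that[of x] \<open>x \<noteq> 0\<close> by blast
qed

text \<open>The first-order condition at a maximum: a linear term dominated by a quadratic one vanishes.\<close>

lemma linear_le_quadratic_imp_zero:
  fixes b c :: real
  assumes "\<And>t. 2 * t * b \<le> t\<^sup>2 * c"
  shows "b = 0"
proof (rule ccontr)
  assume "b \<noteq> 0"
  \<comment> \<open>At \<open>t = s * b\<close> with \<open>s\<close> this small the quadratic term is less than half the linear one.\<close>
  define s where "s = 1 / (\<bar>c\<bar> + 1)"
  have s: "s > 0" "s * c < 1"
    by (auto simp: s_def field_simps)
  have "2 * (s * b) * b \<le> (s * b)\<^sup>2 * c"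
    by (rule assms)
  then have "(s * b\<^sup>2) * 2 \<le> (s * b\<^sup>2) * (s * c)"
    by (simp add: power2_eq_square algebra_simps)
  moreover have "s * b\<^sup>2 > 0"
    using s \<open>b \<noteq> 0\<close> by simp
  ultimately have "2 \<le> s * c"
    by (simp add: mult_le_cancel_left_pos)
  with s show False by simp
qed

text \<open>The next eigenvector is a maximizer of the quadratic form on the unit sphere of the orthogonal
  complement of the previous ones. The last clause, the bound on the form on this complement,
  is carried through the induction because it puts the new eigenvalue below the old ones.\<close>

lemma partial_eigenbasis:
  fixes S :: "'a::euclidean_space \<Rightarrow> 'a"
  assumes lin: "linear S" and sym: "\<And>x y. x \<bullet> S y = S x \<bullet> y" and "k \<le> DIM('a)"
  shows "\<exists>e l. orthonormal_family e k \<and> (\<forall>i<k. S (e i) = l i *\<^sub>R e i) \<and>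
           (\<forall>i j. i \<le> j \<longrightarrow> j < k \<longrightarrow> l j \<le> l i) \<and>
           (\<forall>x. (\<forall>i<k. e i \<bullet> x = 0) \<longrightarrow> (\<forall>i<k. x \<bullet> S x \<le> l i * (x \<bullet> x)))"
  using \<open>k \<le> DIM('a)\<close>
proof (induction k)
  case 0
  then show ?case by (simp add: orthonormal_family_def)
next
  case (Suc k)
  then have "k \<le> DIM('a)"
    by simp
  from Suc.IH[OF this] obtain e :: "nat \<Rightarrow> 'a" and l :: "nat \<Rightarrow> real"
    where on: "orthonormal_family e k"
    and eig': "\<forall>i<k. S (e i) = l i *\<^sub>R e i"
    and dec': "\<forall>i j. i \<le> j \<longrightarrow> j < k \<longrightarrow> l j \<le> l i"
    and bd': "\<forall>x. (\<forall>i<k. e i \<bullet> x = 0) \<longrightarrow> (\<forall>i<k. x \<bullet> S x \<le> l i * (x \<bullet> x))"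
    by (elim exE conjE) (rule that)
  note eig = eig'[rule_format] and dec = dec'[rule_format]
  have bd: "x \<bullet> S x \<le> l i * (x \<bullet> x)" if "\<forall>i<k. e i \<bullet> x = 0" "i < k" for x i
    using bd' that by simp
  define U where "U = {x. \<forall>i<k. e i \<bullet> x = 0}"
  have U_add: "x + t *\<^sub>R y \<in> U" if "x \<in> U" "y \<in> U" for x y t
    using that by (simp add: U_def inner_add_right)
  have U_scale: "t *\<^sub>R y \<in> U" if "y \<in> U" for y t
    using that by (simp add: U_def)
  have contS: "continuous_on A S" for A
    using lin linear_continuous_on linear_conv_bounded_linear by blast
  have "closed U"
  proof -
    have "U = (\<Inter>i\<in>{..<k}. {x. e i \<bullet> x = 0})"
      by (auto simp: U_def)
    then show ?thesis
      by (simp add: closed_hyperplane closed_INT)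
  qed
  then have comp: "compact (sphere 0 1 \<inter> U)"
    by (intro compact_Int_closed) auto
  obtain z where "z \<noteq> 0" "\<And>i. i < k \<Longrightarrow> e i \<bullet> z = 0"
    using exists_common_orthogonal[of "{..<k}" "{}" e e] Suc.prems by auto
  then have "z \<in> U"
    by (simp add: U_def)
  then have "(1 / norm z) *\<^sub>R z \<in> sphere 0 1 \<inter> U"
    using \<open>z \<noteq> 0\<close> U_scale[of z "1 / norm z"] by simp
  then have ne: "sphere 0 1 \<inter> U \<noteq> {}"
    by blast
  have "continuous_on (sphere 0 1 \<inter> U) (\<lambda>x. x \<bullet> S x)"
    by (intro continuous_intros contS)
  from continuous_attains_sup[OF comp ne this]
  obtain u where u: "norm u = 1" "u \<in> U"
    and umax: "\<And>x. norm x = 1 \<Longrightarrow> x \<in> U \<Longrightarrow> x \<bullet> S x \<le> u \<bullet> S u"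
    by auto
  define m where "m = u \<bullet> S u"
  have uu: "u \<bullet> u = 1"
    using u by (simp add: norm_eq_1)
  have Umax: "x \<bullet> S x \<le> m * (x \<bullet> x)" if "x \<in> U" for x
  proof (cases "x = 0")
    case True
    then show ?thesis by simp
  next
    case False
    let ?y = "(1 / norm x) *\<^sub>R x"
    have quot: "?y \<bullet> S ?y = (x \<bullet> S x) / (x \<bullet> x)"
      using lin by (simp add: linear_scale dot_square_norm power2_eq_square)
    have "?y \<bullet> S ?y \<le> m"
      unfolding m_def using False that U_scale by (intro umax) auto
    then have "(x \<bullet> S x) / (x \<bullet> x) \<le> m"
      unfolding quot .
    then show ?thesis
      using False by (simp add: divide_le_eq)
  qed
  have crit: "S u \<bullet> y = 0" if "y \<in> U" "u \<bullet> y = 0" for y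
  proof (rule linear_le_quadratic_imp_zero)
    fix t :: real
    have "(u + t *\<^sub>R y) \<bullet> S (u + t *\<^sub>R y) = m + 2 * t * (S u \<bullet> y) + t\<^sup>2 * (y \<bullet> S y)"
      using lin sym[of u y] inner_commute[of y "S u"]
      by (simp add: linear_add linear_scale inner_add_left inner_add_right m_def
          power2_eq_square algebra_simps)
    moreover have "(u + t *\<^sub>R y) \<bullet> (u + t *\<^sub>R y) = 1 + t\<^sup>2 * (y \<bullet> y)"
      using that uu inner_commute[of y u]
      by (simp add: inner_add_left inner_add_right power2_eq_square)
    ultimately have "m + 2 * t * (S u \<bullet> y) + t\<^sup>2 * (y \<bullet> S y) \<le> m * (1 + t\<^sup>2 * (y \<bullet> y))"
      using Umax[OF U_add[OF u(2) that(1), of t]] by simp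
    then show "2 * t * (S u \<bullet> y) \<le> t\<^sup>2 * (m * (y \<bullet> y) - y \<bullet> S y)"
      by (simp add: algebra_simps)
  qed
  \<comment> \<open>The residual \<open>w\<close> is itself an admissible direction of variation, hence orthogonal to itself.\<close>
  define w where "w = S u - m *\<^sub>R u"
  have "w \<in> U"
    using u(2) sym eig by (simp add: U_def w_def inner_diff_right)
  moreover have "u \<bullet> w = 0"
    using uu by (simp add: w_def inner_diff_right m_def)
  ultimately have "w \<bullet> w = 0"
    using crit[of w] by (simp add: w_def inner_diff_left)
  then have eigu: "S u = m *\<^sub>R u"
    by (simp add: w_def)
  let ?e = "e(k := u)" and ?l = "l(k := m)"
  have "orthonormal_family ?e (Suc k)"
    using on u(2) uu by (auto simp: orthonormal_family_def U_def less_Suc_eq inner_commute)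
  moreover have "\<forall>i<Suc k. S (?e i) = ?l i *\<^sub>R ?e i"
    using eig eigu by (auto simp: less_Suc_eq)
  moreover have "\<forall>i j. i \<le> j \<longrightarrow> j < Suc k \<longrightarrow> ?l j \<le> ?l i"
    using dec bd[of u] u(2) uu by (auto simp: less_Suc_eq U_def m_def)
  moreover have "\<forall>x. (\<forall>i<Suc k. ?e i \<bullet> x = 0) \<longrightarrow> (\<forall>i<Suc k. x \<bullet> S x \<le> ?l i * (x \<bullet> x))"
    using bd Umax by (auto simp: less_Suc_eq U_def)
  ultimately show ?case by blast
qed

theorem symmetric_eigenbasis:
  fixes S :: "'a::euclidean_space \<Rightarrow> 'a"
  assumes "linear S" and "\<And>x y. x \<bullet> S y = S x \<bullet> y"
  obtains e l where "orthonormal_family e DIM('a)" "\<And>i. i < DIM('a) \<Longrightarrow> S (e i) = l i *\<^sub>R e i"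
    "\<And>i j. i \<le> j \<Longrightarrow> j < DIM('a) \<Longrightarrow> l j \<le> l i"
  using partial_eigenbasis[OF assms order_refl] by blast

section \<open>Moving inside the cube\<close>

text \<open>Since \<open>v i\<close> is a unit vector, the left-hand side is an affine function of each \<open>y i\<close>, so each
  coordinate can be moved to an end point of its interval without decreasing it. The offset \<open>w\<close>
  holds the coordinates that are already rounded.\<close>

lemma round_to_signs:
  fixes v :: "nat \<Rightarrow> 'a::real_inner"
  assumes "\<And>i. i < n \<Longrightarrow> norm (v i) = 1" and "\<And>i. i < n \<Longrightarrow> \<bar>y i\<bar> \<le> 1"
  shows "\<exists>\<epsilon> :: nat \<Rightarrow> real. (\<forall>i<n. \<epsilon> i \<in> {1, -1}) \<and>
           (norm (w + (\<Sum>i<n. y i *\<^sub>R v i)))\<^sup>2 + (\<Sum>i<n. 1 - (y i)\<^sup>2)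
             \<le> (norm (w + (\<Sum>i<n. \<epsilon> i *\<^sub>R v i)))\<^sup>2"
  using assms
proof (induction n arbitrary: w)
  case 0
  then show ?case by simp
next
  case (Suc n)
  define w' where "w' = w + (\<Sum>i<n. y i *\<^sub>R v i)"
  define s :: real where "s = (if w' \<bullet> v n \<ge> 0 then 1 else -1)"
  have vn: "v n \<bullet> v n = 1"
    using Suc.prems(1)[of n] by (simp add: norm_eq_1)
  have sq: "(norm (w' + c *\<^sub>R v n))\<^sup>2 = (norm w')\<^sup>2 + 2 * (c * (w' \<bullet> v n)) + c\<^sup>2" for c
    unfolding power2_norm_eq_inner using vn
    by (simp add: inner_add_left inner_add_right inner_commute power2_eq_square)
  have "y n * (w' \<bullet> v n) \<le> \<bar>w' \<bullet> v n\<bar>"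
    using Suc.prems(2)[of n]
    by (metis abs_ge_self abs_ge_zero abs_mult lessI mult_left_le_one_le order_trans)
  also have "\<dots> = s * (w' \<bullet> v n)"
    by (simp add: s_def)
  finally have step: "(norm (w' + y n *\<^sub>R v n))\<^sup>2 + (1 - (y n)\<^sup>2) \<le> (norm (w' + s *\<^sub>R v n))\<^sup>2"
    unfolding sq by (simp add: s_def split: if_splits)
  obtain \<epsilon> :: "nat \<Rightarrow> real" where \<epsilon>: "\<And>i. i < n \<Longrightarrow> \<epsilon> i \<in> {1, -1}"
    "(norm ((w + s *\<^sub>R v n) + (\<Sum>i<n. y i *\<^sub>R v i)))\<^sup>2 + (\<Sum>i<n. 1 - (y i)\<^sup>2)
       \<le> (norm ((w + s *\<^sub>R v n) + (\<Sum>i<n. \<epsilon> i *\<^sub>R v i)))\<^sup>2"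
    using Suc.IH[of "w + s *\<^sub>R v n"] Suc.prems by (meson less_Suc_eq)
  let ?\<epsilon> = "\<epsilon>(n := s)"
  have "\<forall>i<Suc n. ?\<epsilon> i \<in> {1, -1}"
    using \<epsilon>(1) by (auto simp: less_Suc_eq s_def)
  moreover have "(norm (w + (\<Sum>i<Suc n. y i *\<^sub>R v i)))\<^sup>2 + (\<Sum>i<Suc n. 1 - (y i)\<^sup>2)
             \<le> (norm (w + (\<Sum>i<Suc n. ?\<epsilon> i *\<^sub>R v i)))\<^sup>2"
    using step \<epsilon>(2) by (simp add: w'_def algebra_simps)
  ultimately show ?case by blast
qed

lemma first_exit_from_cube:
  fixes a b :: "'i \<Rightarrow> real"
  assumes fin: "finite I" and a: "\<And>i. i \<in> I \<Longrightarrow> \<bar>a i\<bar> \<le> 1" and ex: "\<exists>i\<in>I. b i \<noteq> 0"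
  obtains t where "t \<ge> 0" "\<And>i. i \<in> I \<Longrightarrow> \<bar>a i + t * b i\<bar> \<le> 1"
    "\<exists>i\<in>I. b i \<noteq> 0 \<and> \<bar>a i + t * b i\<bar> = 1"
proof -
  define J where "J = {i\<in>I. b i \<noteq> 0}"
  define \<tau> where "\<tau> i = (1 - sgn (b i) * a i) / \<bar>b i\<bar>" for i
  have J: "finite J" "J \<noteq> {}"
    using fin ex by (auto simp: J_def)
  define t where "t = Min (\<tau> ` J)"
  obtain p where p: "p \<in> J" "t = \<tau> p"
    using Min_in[of "\<tau> ` J"] J unfolding t_def by blast
  have le: "t \<le> \<tau> i" if "i \<in> J" for i
    using that J by (simp add: t_def)
  have exit: "sgn (b i) * (a i + \<tau> i * b i) = 1" if "i \<in> J" for i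
    using that by (auto simp: J_def \<tau>_def sgn_if field_simps)
  have pos: "\<tau> i \<ge> 0" if "i \<in> J" for i
    using that a[of i] by (auto simp: J_def \<tau>_def sgn_if)
  have t0: "t \<ge> 0"
    using p pos by simp
  have "\<bar>a i + t * b i\<bar> \<le> 1" if "i \<in> I" for i
  proof (cases "b i = 0")
    case True
    then show ?thesis using a that by simp
  next
    case False
    then have iJ: "i \<in> J" using that by (simp add: J_def)
    show ?thesis
    proof (cases "b i > 0")
      case True
      have "t * b i \<le> \<tau> i * b i" "0 \<le> t * b i"
        using le[OF iJ] t0 True by (auto intro: mult_right_mono)
      moreover have "a i + \<tau> i * b i = 1"
        using exit[OF iJ] True by simp
      ultimately show ?thesis
        using a[OF that] by linarith
    next
      case neg: False
      have "\<tau> i * b i \<le> t * b i" "t * b i \<le> 0"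
        using le[OF iJ] t0 neg by (auto intro: mult_right_mono_neg simp: mult_nonneg_nonpos)
      moreover have "a i + \<tau> i * b i = -1"
        using exit[OF iJ] neg False by simp
      ultimately show ?thesis
        using a[OF that] by linarith
    qed
  qed
  moreover have "\<bar>a p + t * b p\<bar> = 1"
    using exit[OF p(1)] p by (auto simp: J_def sgn_if split: if_splits)
  ultimately show ?thesis
    using that t0 p(1) unfolding J_def by blast
qed

section \<open>The frame operator\<close>

definition frame_op :: "(nat \<Rightarrow> 'a::real_inner) \<Rightarrow> nat \<Rightarrow> 'a \<Rightarrow> 'a" where
  "frame_op v n x = (\<Sum>i<n. (v i \<bullet> x) *\<^sub>R v i)"

lemma linear_frame_op: "linear (frame_op v n)"
  by (rule linearI)
    (simp_all add: frame_op_def inner_add_right scaleR_add_left sum.distrib scaleR_sum_right)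

lemma frame_op_symmetric: "x \<bullet> frame_op v n y = frame_op v n x \<bullet> y"
  unfolding frame_op_def
  by (simp add: inner_sum_left inner_sum_right inner_commute mult.commute)

lemma inner_frame_op_self: "x \<bullet> frame_op v n x = (\<Sum>i<n. (v i \<bullet> x)\<^sup>2)"
  unfolding frame_op_def
  by (simp add: inner_sum_right inner_commute[of x] power2_eq_square)

text \<open>Exchanging the sums, each unit vector contributes its squared norm to the trace.\<close>

lemma trace_frame_op:
  fixes v :: "nat \<Rightarrow> 'a::euclidean_space"
  assumes on: "orthonormal_family e DIM('a)" and v: "\<And>i. i < n \<Longrightarrow> norm (v i) = 1"
  shows "(\<Sum>j<DIM('a). e j \<bullet> frame_op v n (e j)) = real n"
proof -
  have "(\<Sum>j<DIM('a). e j \<bullet> frame_op v n (e j)) = (\<Sum>j<DIM('a). \<Sum>i<n. (v i \<bullet> e j)\<^sup>2)"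
    by (simp add: inner_frame_op_self)
  also have "\<dots> = (\<Sum>i<n. \<Sum>j<DIM('a). (v i \<bullet> e j) * (v i \<bullet> e j))"
    by (subst sum.swap) (simp add: power2_eq_square)
  also have "\<dots> = (\<Sum>i<n. v i \<bullet> v i)"
    by (simp add: orthonormal_family_inner[OF on, symmetric])
  also have "\<dots> = real n"
    using v by (simp add: norm_eq_1)
  finally show ?thesis .
qed

text \<open>The hypothesis \<open>top\<close> says that \<open>x\<close> lies in the span of the eigenvectors with eigenvalue at
  least \<open>c\<close>; in coordinates the two bounds compare \<open>l j\<close> with \<open>c\<close> term by term.\<close>

lemma top_eigenspace_bounds:
  fixes S :: "'a::euclidean_space \<Rightarrow> 'a"
  assumes sym: "\<And>x y. x \<bullet> S y = S x \<bullet> y"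
    and on: "orthonormal_family e DIM('a)"
    and eig: "\<And>i. i < DIM('a) \<Longrightarrow> S (e i) = l i *\<^sub>R e i"
    and top: "\<And>j. j < DIM('a) \<Longrightarrow> x \<bullet> e j \<noteq> 0 \<Longrightarrow> c \<le> l j" and "0 \<le> c"
  shows "c * (x \<bullet> x) \<le> x \<bullet> S x" and "c * (x \<bullet> S x) \<le> S x \<bullet> S x"
proof -
  have coord: "S x \<bullet> e j = l j * (x \<bullet> e j)" if "j < DIM('a)" for j
    using eig[OF that] sym[of x "e j"] by simp
  have le: "c * (x \<bullet> e j)\<^sup>2 \<le> l j * (x \<bullet> e j)\<^sup>2" if "j < DIM('a)" for j
    using top[OF that] by (cases "x \<bullet> e j = 0") (auto intro: mult_right_mono)
  have le2: "c * (l j * (x \<bullet> e j)\<^sup>2) \<le> l j * (l j * (x \<bullet> e j)\<^sup>2)" if "j < DIM('a)" for j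
    using top[OF that] \<open>0 \<le> c\<close>
    by (cases "x \<bullet> e j = 0") (auto intro!: mult_right_mono mult_nonneg_nonneg)
  have xx: "x \<bullet> x = (\<Sum>j<DIM('a). (x \<bullet> e j)\<^sup>2)"
    by (subst orthonormal_family_inner[OF on]) (simp add: power2_eq_square)
  have xS: "x \<bullet> S x = (\<Sum>j<DIM('a). l j * (x \<bullet> e j)\<^sup>2)"
    by (subst orthonormal_family_inner[OF on])
      (auto simp: power2_eq_square coord intro!: sum.cong)
  have SS: "S x \<bullet> S x = (\<Sum>j<DIM('a). l j * (l j * (x \<bullet> e j)\<^sup>2))"
    by (subst orthonormal_family_inner[OF on])
      (auto simp: power2_eq_square coord intro!: sum.cong)
  show "c * (x \<bullet> x) \<le> x \<bullet> S x"
    unfolding xx xS sum_distrib_left by (intro sum_mono le) simp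
  show "c * (x \<bullet> S x) \<le> S x \<bullet> S x"
    unfolding xS SS sum_distrib_left by (intro sum_mono le2) simp
qed

section \<open>The walk and the lower bound\<close>

text \<open>By \<open>conv\<close>, the function \<open>S x \<bullet> S x - c * (x \<bullet> S x)\<close> is convex along the line through \<open>x\<close> in
  direction \<open>z\<close>, so it is nondecreasing in one of the two directions. Following that direction until
  a new coordinate \<open>v i \<bullet> x\<close> reaches 1 or -1 stays in the cube; \<open>nz\<close> ensures that some coordinate
  moves at all, and \<open>dir\<close> that the coordinates already on the boundary stay there.\<close>

lemma tight_point_step:
  fixes v :: "nat \<Rightarrow> 'a::euclidean_space" and n :: nat
  defines "S \<equiv> frame_op v n"
  assumes bd: "\<And>i. i < n \<Longrightarrow> \<bar>v i \<bullet> x\<bar> \<le> 1"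
    and dir: "\<And>i. i < n \<Longrightarrow> \<bar>v i \<bullet> x\<bar> = 1 \<Longrightarrow> v i \<bullet> z = 0"
    and nz: "z \<bullet> S z \<noteq> 0"
    and conv: "c * (z \<bullet> S z) \<le> S z \<bullet> S z"
  obtains t where "\<And>i. i < n \<Longrightarrow> \<bar>v i \<bullet> (x + t *\<^sub>R z)\<bar> \<le> 1"
    and "{i\<in>{..<n}. \<bar>v i \<bullet> x\<bar> = 1} \<subset> {i\<in>{..<n}. \<bar>v i \<bullet> (x + t *\<^sub>R z)\<bar> = 1}"
    and "S x \<bullet> S x - c * (x \<bullet> S x)
           \<le> S (x + t *\<^sub>R z) \<bullet> S (x + t *\<^sub>R z) - c * ((x + t *\<^sub>R z) \<bullet> S (x + t *\<^sub>R z))"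
proof -
  define b where "b = S x \<bullet> S z - c * (x \<bullet> S z)"
  define s :: real where "s = (if b \<ge> 0 then 1 else -1)"
  have s: "s * b \<ge> 0" "s \<noteq> 0"
    by (simp_all add: s_def)
  have "\<exists>i\<in>{..<n}. s * (v i \<bullet> z) \<noteq> 0"
  proof (rule ccontr)
    assume "\<not> ?thesis"
    then have "z \<bullet> S z = 0"
      using s(2) by (simp add: S_def inner_frame_op_self)
    with nz show False by contradiction
  qed
  then obtain t where t: "t \<ge> 0" "\<And>i. i \<in> {..<n} \<Longrightarrow> \<bar>v i \<bullet> x + t * (s * (v i \<bullet> z))\<bar> \<le> 1"
    and new: "\<exists>i\<in>{..<n}. s * (v i \<bullet> z) \<noteq> 0 \<and> \<bar>v i \<bullet> x + t * (s * (v i \<bullet> z))\<bar> = 1"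
    using first_exit_from_cube[of "{..<n}" "\<lambda>i. v i \<bullet> x" "\<lambda>i. s * (v i \<bullet> z)"] bd by auto
  have coord: "v i \<bullet> (x + (t * s) *\<^sub>R z) = v i \<bullet> x + t * (s * (v i \<bullet> z))" for i
    by (simp add: inner_add_right)
  have "\<bar>v i \<bullet> (x + (t * s) *\<^sub>R z)\<bar> \<le> 1" if "i < n" for i
    unfolding coord using t(2) that by simp
  moreover have "{i\<in>{..<n}. \<bar>v i \<bullet> x\<bar> = 1} \<subset> {i\<in>{..<n}. \<bar>v i \<bullet> (x + (t * s) *\<^sub>R z)\<bar> = 1}"
  proof -
    have "v i \<bullet> z = 0 \<and> \<bar>v i \<bullet> x + t * (s * (v i \<bullet> z))\<bar> = 1" if "i < n" "\<bar>v i \<bullet> x\<bar> = 1" for i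
      using dir[OF that] that by simp
    moreover obtain p where "p < n" "v p \<bullet> z \<noteq> 0" "\<bar>v p \<bullet> x + t * (s * (v p \<bullet> z))\<bar> = 1"
      using new by auto
    ultimately show ?thesis
      unfolding coord by blast
  qed
  moreover have "S x \<bullet> S x - c * (x \<bullet> S x)
    \<le> S (x + (t * s) *\<^sub>R z) \<bullet> S (x + (t * s) *\<^sub>R z)
       - c * ((x + (t * s) *\<^sub>R z) \<bullet> S (x + (t * s) *\<^sub>R z))"
  proof -
    have lin: "S (x + r *\<^sub>R z) = S x + r *\<^sub>R S z" for r
      unfolding S_def by (simp add: linear_frame_op linear_add linear_scale)
    have sym: "z \<bullet> S x = x \<bullet> S z"
      unfolding S_def by (metis frame_op_symmetric inner_commute)
    have "S (x + r *\<^sub>R z) \<bullet> S (x + r *\<^sub>R z) - c * ((x + r *\<^sub>R z) \<bullet> S (x + r *\<^sub>R z))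
        = S x \<bullet> S x - c * (x \<bullet> S x) + 2 * r * b + r\<^sup>2 * (S z \<bullet> S z - c * (z \<bullet> S z))" for r
      unfolding lin b_def
      by (simp add: inner_add_left inner_add_right sym inner_commute[of "S z" "S x"]
          power2_eq_square algebra_simps)
    moreover have "2 * (t * s) * b \<ge> 0"
      using t(1) s(1) by (simp add: mult.assoc)
    moreover have "(t * s)\<^sup>2 * (S z \<bullet> S z - c * (z \<bullet> S z)) \<ge> 0"
      using conv by simp
    ultimately show ?thesis by simp
  qed
  ultimately show ?thesis by (rule that)
qed

text \<open>The induction is a summation by parts. The gain is stated for every \<open>c\<close> below the eigenvalues
  used so far (or equal to them): the slack \<open>x \<bullet> S x - k\<close>, which is nonnegative because \<open>k\<close> of the coordinates have
  square 1, may then be weighted by the next, smaller eigenvalue.\<close>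

lemma eigenspace_walk:
  fixes v :: "nat \<Rightarrow> 'a::euclidean_space" and n :: nat
  defines "S \<equiv> frame_op v n"
  assumes on: "orthonormal_family e DIM('a)"
    and eig: "\<And>i. i < DIM('a) \<Longrightarrow> S (e i) = l i *\<^sub>R e i"
    and dec: "\<And>i j. i \<le> j \<Longrightarrow> j < DIM('a) \<Longrightarrow> l j \<le> l i"
    and "k \<le> DIM('a)" and "\<And>j. j < k \<Longrightarrow> 1 \<le> l j"
  shows "\<exists>x. (\<forall>j. k \<le> j \<longrightarrow> j < DIM('a) \<longrightarrow> e j \<bullet> x = 0) \<and> (\<forall>i<n. \<bar>v i \<bullet> x\<bar> \<le> 1) \<and>
           k \<le> card {i\<in>{..<n}. \<bar>v i \<bullet> x\<bar> = 1} \<and>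
           (\<forall>c. (\<forall>j<k. c \<le> l j) \<longrightarrow>
              (\<Sum>j<k. l j - 1) + (c - 1) * (x \<bullet> S x - real k) \<le> S x \<bullet> S x - x \<bullet> S x)"
  using assms(5,6)
proof (induction k)
  case 0
  have "S 0 = 0"
    unfolding S_def by (simp add: linear_0 linear_frame_op)
  then show ?case by (intro exI[of _ 0]) simp
next
  case (Suc k)
  let ?F = "\<lambda>x. {i\<in>{..<n}. \<bar>v i \<bullet> x\<bar> = 1}"
  have tight: "real (card (?F x)) \<le> x \<bullet> S x" for x
  proof -
    have "real (card (?F x)) = (\<Sum>i\<in>?F x. (v i \<bullet> x)\<^sup>2)"
    proof -
      have "(v i \<bullet> x)\<^sup>2 = 1" if "i \<in> ?F x" for i
        using that by (metis (mono_tags, lifting) mem_Collect_eq one_power2 power2_abs)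
      then show ?thesis
        by (simp del: mem_Collect_eq)
    qed
    also have "\<dots> \<le> (\<Sum>i<n. (v i \<bullet> x)\<^sup>2)"
      by (intro sum_mono2) auto
    finally show ?thesis by (simp add: S_def inner_frame_op_self)
  qed
  obtain x where xV': "\<forall>j. k \<le> j \<longrightarrow> j < DIM('a) \<longrightarrow> e j \<bullet> x = 0"
    and xbd': "\<forall>i<n. \<bar>v i \<bullet> x\<bar> \<le> 1" and xF: "k \<le> card (?F x)"
    and gain: "\<forall>c. (\<forall>j<k. c \<le> l j) \<longrightarrow>
       (\<Sum>j<k. l j - 1) + (c - 1) * (x \<bullet> S x - real k) \<le> S x \<bullet> S x - x \<bullet> S x"
    by (atomize_elim, rule Suc.IH) (use Suc.prems in auto)
  note xV = xV'[rule_format] and xbd = xbd'[rule_format]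
  have lk: "1 \<le> l k" "\<And>j. j < k \<Longrightarrow> l k \<le> l j"
    using Suc.prems dec by auto
  have "\<exists>y. (\<forall>j. Suc k \<le> j \<longrightarrow> j < DIM('a) \<longrightarrow> e j \<bullet> y = 0) \<and> (\<forall>i<n. \<bar>v i \<bullet> y\<bar> \<le> 1) \<and>
           Suc k \<le> card (?F y) \<and>
           S x \<bullet> S x - l k * (x \<bullet> S x) \<le> S y \<bullet> S y - l k * (y \<bullet> S y)"
  proof (cases "Suc k \<le> card (?F x)")
    case True
    then show ?thesis using xV xbd by (intro exI[of _ x]) auto
  next
    case False
    with xF have "card (?F x) = k" by simp
    \<comment> \<open>The \<open>k\<close> tight coordinates and the \<open>d - k - 1\<close> excluded eigenvectors impose \<open>d - 1\<close> conditions.\<close>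
    then have "card (?F x) + card {Suc k..<DIM('a)} < DIM('a)"
      using Suc.prems(1) by simp
    then obtain z where z: "z \<noteq> 0" "\<And>i. i \<in> ?F x \<Longrightarrow> v i \<bullet> z = 0"
      and zV: "\<And>j. j \<in> {Suc k..<DIM('a)} \<Longrightarrow> e j \<bullet> z = 0"
      using exists_common_orthogonal[of "?F x" "{Suc k..<DIM('a)}" v e] by auto
    have top: "l k \<le> l j" if "j < DIM('a)" "z \<bullet> e j \<noteq> 0" for j
    proof -
      have "j \<le> k"
        using zV[of j] that by (force simp: inner_commute)
      then show ?thesis using lk(2) le_neq_implies_less by blast
    qed
    have symS: "a \<bullet> S b = S a \<bullet> b" for a b
      by (simp add: S_def frame_op_symmetric)
    note zb = top_eigenspace_bounds[of S e l z "l k", OF symS on eig top]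
    have "l k * (z \<bullet> z) \<le> z \<bullet> S z" and conv: "l k * (z \<bullet> S z) \<le> S z \<bullet> S z"
      using zb lk(1) by auto
    moreover have "l k * (z \<bullet> z) > 0"
      using z(1) lk(1) by simp
    ultimately have nz: "z \<bullet> S z \<noteq> 0"
      by linarith
    obtain t where t: "\<And>i. i < n \<Longrightarrow> \<bar>v i \<bullet> (x + t *\<^sub>R z)\<bar> \<le> 1" "?F x \<subset> ?F (x + t *\<^sub>R z)"
      "S x \<bullet> S x - l k * (x \<bullet> S x)
           \<le> S (x + t *\<^sub>R z) \<bullet> S (x + t *\<^sub>R z) - l k * ((x + t *\<^sub>R z) \<bullet> S (x + t *\<^sub>R z))"
      using tight_point_step[of n v x z "l k", folded S_def, OF xbd _ nz conv] z(2) by blast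
    have "card (?F x) < card (?F (x + t *\<^sub>R z))"
      using t(2) by (intro psubset_card_mono) auto
    then have "Suc k \<le> card (?F (x + t *\<^sub>R z))"
      using \<open>card (?F x) = k\<close> by simp
    moreover have "e j \<bullet> (x + t *\<^sub>R z) = 0" if "Suc k \<le> j" "j < DIM('a)" for j
      using xV[of j] zV[of j] that by (simp add: inner_add_right)
    ultimately show ?thesis
      using t by blast
  qed
  then obtain y where y: "\<forall>j. Suc k \<le> j \<longrightarrow> j < DIM('a) \<longrightarrow> e j \<bullet> y = 0"
    "\<forall>i<n. \<bar>v i \<bullet> y\<bar> \<le> 1" "Suc k \<le> card (?F y)"
    and up: "S x \<bullet> S x - l k * (x \<bullet> S x) \<le> S y \<bullet> S y - l k * (y \<bullet> S y)"
    by blast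
  have "(\<Sum>j<Suc k. l j - 1) + (c - 1) * (y \<bullet> S y - real (Suc k)) \<le> S y \<bullet> S y - y \<bullet> S y"
    if c: "\<forall>j<Suc k. c \<le> l j" for c
  proof -
    have "(\<Sum>j<k. l j - 1) + (l k - 1) * (x \<bullet> S x - real k) \<le> S x \<bullet> S x - x \<bullet> S x"
      using gain lk(2) by blast
    with up have "(\<Sum>j<Suc k. l j - 1) + (l k - 1) * (y \<bullet> S y - real (Suc k))
        \<le> S y \<bullet> S y - y \<bullet> S y"
      by (simp add: algebra_simps)
    moreover have "real (Suc k) \<le> y \<bullet> S y"
      using tight[of y] y(3) by linarith
    then have "(c - 1) * (y \<bullet> S y - real (Suc k)) \<le> (l k - 1) * (y \<bullet> S y - real (Suc k))"
      using c by (intro mult_right_mono) auto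
    ultimately show ?thesis by linarith
  qed
  with y show ?case by blast
qed

text \<open>The walk is run over the eigenvalues that are at least 1. The other terms \<open>l j - 1\<close> are
  negative, so the gain is no less than the full sum \<open>n - d\<close>; rounding to signs adds \<open>n\<close>.\<close>

theorem exists_large_sign_sum:
  fixes v :: "nat \<Rightarrow> 'a::euclidean_space"
  assumes v: "\<And>i. i < n \<Longrightarrow> norm (v i) = 1"
  obtains \<epsilon> :: "nat \<Rightarrow> real" where "\<And>i. i < n \<Longrightarrow> \<epsilon> i \<in> {1, -1}"
    "2 * real n - real DIM('a) \<le> (norm (\<Sum>i<n. \<epsilon> i *\<^sub>R v i))\<^sup>2"
proof -
  let ?S = "frame_op v n" and ?d = "DIM('a)"
  obtain e l where on: "orthonormal_family e ?d"
    and eig: "\<And>i. i < ?d \<Longrightarrow> ?S (e i) = l i *\<^sub>R e i"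
    and dec: "\<And>i j. i \<le> j \<Longrightarrow> j < ?d \<Longrightarrow> l j \<le> l i"
    using symmetric_eigenbasis[of ?S] linear_frame_op frame_op_symmetric by metis
  define m where "m = (LEAST j. j = ?d \<or> l j < 1)"
  have m: "m = ?d \<or> l m < 1" "m \<le> ?d"
    unfolding m_def by (rule LeastI2[of _ ?d], auto intro: Least_le)
  have big: "1 \<le> l j" if "j < m" for j
    using not_less_Least[of j "\<lambda>j. j = ?d \<or> l j < 1"] that by (simp add: m_def)
  have small: "l j < 1" if "m \<le> j" "j < ?d" for j
    using m that dec[of m j] by auto
  have "real n - real ?d = (\<Sum>j<?d. l j - 1)"
  proof -
    have "(\<Sum>j<?d. e j \<bullet> ?S (e j)) = real n"
      by (rule trace_frame_op[OF on]) (rule v)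
    then show ?thesis
      using eig orthonormal_familyD[OF on] by (simp add: sum_subtractf)
  qed
  also have "\<dots> \<le> (\<Sum>j<m. l j - 1)"
    using m(2) small sum.subset_diff[of "{..<m}" "{..<?d}" "\<lambda>j. l j - 1"]
      sum_nonpos[of "{..<?d} - {..<m}" "\<lambda>j. l j - 1"] by force
  finally have surplus: "real n - real ?d \<le> (\<Sum>j<m. l j - 1)" .
  have "\<exists>x. (\<forall>i<n. \<bar>v i \<bullet> x\<bar> \<le> 1) \<and> (\<forall>c. (\<forall>j<m. c \<le> l j) \<longrightarrow>
       (\<Sum>j<m. l j - 1) + (c - 1) * (x \<bullet> ?S x - real m) \<le> ?S x \<bullet> ?S x - x \<bullet> ?S x)"
    using eigenspace_walk[of e v n l m, OF on eig dec m(2) big] by fast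
  then obtain x where x: "\<forall>i<n. \<bar>v i \<bullet> x\<bar> \<le> 1"
    and "\<forall>c. (\<forall>j<m. c \<le> l j) \<longrightarrow>
       (\<Sum>j<m. l j - 1) + (c - 1) * (x \<bullet> ?S x - real m) \<le> ?S x \<bullet> ?S x - x \<bullet> ?S x"
    by (elim exE conjE) (rule that)
  from this(2)[rule_format, of 1] big surplus
  have gain: "real n - real ?d \<le> ?S x \<bullet> ?S x - x \<bullet> ?S x"
    by simp
  obtain \<epsilon> :: "nat \<Rightarrow> real" where \<epsilon>: "\<And>i. i < n \<Longrightarrow> \<epsilon> i \<in> {1, -1}"
    "(norm (0 + (\<Sum>i<n. (v i \<bullet> x) *\<^sub>R v i)))\<^sup>2 + (\<Sum>i<n. 1 - (v i \<bullet> x)\<^sup>2)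
             \<le> (norm (0 + (\<Sum>i<n. \<epsilon> i *\<^sub>R v i)))\<^sup>2"
    using round_to_signs[of n v "\<lambda>i. v i \<bullet> x" 0] v x by blast
  have "(norm (0 + (\<Sum>i<n. (v i \<bullet> x) *\<^sub>R v i)))\<^sup>2 + (\<Sum>i<n. 1 - (v i \<bullet> x)\<^sup>2)
      = ?S x \<bullet> ?S x + (real n - x \<bullet> ?S x)"
    by (simp add: power2_norm_eq_inner frame_op_def[symmetric] sum_subtractf inner_frame_op_self)
  with gain \<epsilon> show ?thesis
    by (intro that[of \<epsilon>]) auto
qed

section \<open>The extremal configuration\<close>

lemma norm_square_sum_orthonormal:
  fixes e :: "nat \<Rightarrow> 'a::real_inner"
  assumes on: "orthonormal_family e d"
  shows "(norm (\<Sum>j<d. a j *\<^sub>R e j))\<^sup>2 = (\<Sum>j<d. (a j)\<^sup>2)"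
proof -
  have "(\<Sum>j<d. a j *\<^sub>R e j) \<bullet> (\<Sum>j<d. a j *\<^sub>R e j)
      = (\<Sum>i<d. \<Sum>j<d. if i = j then (a i)\<^sup>2 else 0)"
    unfolding inner_sum_left inner_sum_right
    by (intro sum.cong refl)
      (simp add: orthonormal_familyD[OF on] power2_eq_square)
  also have "\<dots> = (\<Sum>j<d. (a j)\<^sup>2)"
    by simp
  finally show ?thesis by (simp add: power2_norm_eq_inner)
qed

text \<open>The vectors \<open>3 * j\<close>, \<open>3 * j + 1\<close> and \<open>3 * j + 2\<close> form a triple at mutual angles of 120
  degrees in the plane of \<open>b (2 * j)\<close> and \<open>b (2 * j + 1)\<close>.\<close>

definition triple_vec :: "(nat \<Rightarrow> 'a::real_vector) \<Rightarrow> nat \<Rightarrow> 'a" where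
  "triple_vec b i = (let j = i div 3 in
     if i mod 3 = 0 then b (2 * j)
     else (-1/2) *\<^sub>R b (2 * j) + ((if i mod 3 = 1 then 1 else -1) * sqrt 3 / 2) *\<^sub>R b (2 * j + 1))"

lemma triple_vec_simps:
  "triple_vec b (3 * j) = b (2 * j)"
  "triple_vec b (3 * j + 1) = (-1/2) *\<^sub>R b (2 * j) + (sqrt 3 / 2) *\<^sub>R b (2 * j + 1)"
  "triple_vec b (3 * j + 2) = (-1/2) *\<^sub>R b (2 * j) + (- sqrt 3 / 2) *\<^sub>R b (2 * j + 1)"
proof -
  have "(3 * j + 1) div 3 = j" "(3 * j + 1) mod 3 = 1" "(3 * j + 2) div 3 = j" "(3 * j + 2) mod 3 = 2"
    by presburger+
  then show "triple_vec b (3 * j) = b (2 * j)"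
    "triple_vec b (3 * j + 1) = (-1/2) *\<^sub>R b (2 * j) + (sqrt 3 / 2) *\<^sub>R b (2 * j + 1)"
    "triple_vec b (3 * j + 2) = (-1/2) *\<^sub>R b (2 * j) + (- sqrt 3 / 2) *\<^sub>R b (2 * j + 1)"
    unfolding triple_vec_def Let_def by auto
qed

lemma norm_triple_vec:
  assumes on: "orthonormal_family b d" and i: "i < 3 * k" and "2 * k \<le> d"
  shows "norm (triple_vec b i) = 1"
proof -
  define j where "j = i div 3"
  have "j < k"
    using i by (simp add: j_def less_mult_imp_div_less mult.commute)
  then have j: "2 * j < d" "2 * j + 1 < d"
    using assms(3) by auto
  have bb: "b (2 * j) \<bullet> b (2 * j) = 1" "b (2 * j + 1) \<bullet> b (2 * j + 1) = 1"
    "b (2 * j) \<bullet> b (2 * j + 1) = 0" "b (2 * j + 1) \<bullet> b (2 * j) = 0"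
    using orthonormal_familyD[OF on] j by auto
  have "i mod 3 < 3" "i = 3 * j + i mod 3"
    by (simp_all add: j_def)
  then consider "i = 3 * j" | "i = 3 * j + 1" | "i = 3 * j + 2"
    by linarith
  then show ?thesis
    by cases (simp_all only: triple_vec_simps norm_eq_1 inner_add_left inner_add_right
        inner_scaleR_left inner_scaleR_right bb, simp_all)
qed

text \<open>The coordinate at \<open>b j\<close> of the sum of the triple vectors with coefficients \<open>\<epsilon>\<close>.\<close>

definition triple_coord :: "(nat \<Rightarrow> real) \<Rightarrow> nat \<Rightarrow> real" where
  "triple_coord \<epsilon> j = (let i = 3 * (j div 2) in
     if even j then \<epsilon> i - (\<epsilon> (i + 1) + \<epsilon> (i + 2)) / 2
     else sqrt 3 / 2 * (\<epsilon> (i + 1) - \<epsilon> (i + 2)))"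

lemma triple_coord_simps:
  "triple_coord \<epsilon> (2 * j) = \<epsilon> (3 * j) - (\<epsilon> (3 * j + 1) + \<epsilon> (3 * j + 2)) / 2"
  "triple_coord \<epsilon> (2 * j + 1) = sqrt 3 / 2 * (\<epsilon> (3 * j + 1) - \<epsilon> (3 * j + 2))"
  by (simp_all add: triple_coord_def Let_def)

lemma sum_triple_vec:
  "(\<Sum>i<3 * k. \<epsilon> i *\<^sub>R triple_vec b i) = (\<Sum>j<2 * k. triple_coord \<epsilon> j *\<^sub>R b j)"
proof (induction k)
  case 0
  then show ?case by simp
next
  case (Suc k)
  have eq: "3 * Suc k = Suc (Suc (Suc (3 * k)))" "2 * Suc k = Suc (Suc (2 * k))"
    by simp_all
  have sums: "(\<Sum>i<3 * Suc k. \<epsilon> i *\<^sub>R triple_vec b i) = (\<Sum>i<3 * k. \<epsilon> i *\<^sub>R triple_vec b i)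
      + \<epsilon> (3 * k) *\<^sub>R triple_vec b (3 * k) + \<epsilon> (3 * k + 1) *\<^sub>R triple_vec b (3 * k + 1)
      + \<epsilon> (3 * k + 2) *\<^sub>R triple_vec b (3 * k + 2)"
    "(\<Sum>j<2 * Suc k. triple_coord \<epsilon> j *\<^sub>R b j) = (\<Sum>j<2 * k. triple_coord \<epsilon> j *\<^sub>R b j)
      + triple_coord \<epsilon> (2 * k) *\<^sub>R b (2 * k) + triple_coord \<epsilon> (2 * k + 1) *\<^sub>R b (2 * k + 1)"
    unfolding eq by simp_all
  show ?case
    unfolding sums Suc.IH triple_vec_simps triple_coord_simps
    by (simp add: algebra_simps add_divide_distrib diff_divide_distrib)
qed

text \<open>The three vectors of a plane sum to 0. If their signs agree, the signed sum is 0; otherwise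
  it is plus or minus twice the vector with the odd sign, of norm 2.\<close>

lemma sum_triple_coord_squared_le:
  assumes "\<And>i. i < 3 * k \<Longrightarrow> \<epsilon> i \<in> {1, -1}"
  shows "(\<Sum>j<2 * k. (triple_coord \<epsilon> j)\<^sup>2) \<le> 4 * real k"
  using assms
proof (induction k)
  case 0
  then show ?case by simp
next
  case (Suc k)
  have "\<epsilon> (3 * k) \<in> {1, -1}" "\<epsilon> (3 * k + 1) \<in> {1, -1}" "\<epsilon> (3 * k + 2) \<in> {1, -1}"
    using Suc.prems by auto
  then have "(triple_coord \<epsilon> (2 * k))\<^sup>2 + (triple_coord \<epsilon> (2 * k + 1))\<^sup>2 \<le> 4"
    unfolding triple_coord_simps by (auto simp: power2_eq_square field_simps)
  then show ?case
    using Suc by (simp add: algebra_simps)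
qed

theorem exists_small_sign_sums:
  assumes "2 * k \<le> DIM('a::euclidean_space)"
  obtains v :: "nat \<Rightarrow> 'a::euclidean_space" where "\<And>i. i < DIM('a) + k \<Longrightarrow> norm (v i) = 1"
    "\<And>\<epsilon>. (\<And>i. i < DIM('a) + k \<Longrightarrow> \<epsilon> i \<in> {1, -1}) \<Longrightarrow>
       (norm (\<Sum>i<DIM('a) + k. \<epsilon> i *\<^sub>R v i))\<^sup>2 \<le> real DIM('a) + 2 * real k"
proof -
  let ?d = "DIM('a)"
  obtain b :: "nat \<Rightarrow> 'a" where b: "bij_betw b {..<?d} Basis"
    using ex_bij_betw_nat_finite[of "Basis :: 'a set"] by (auto simp: atLeast0LessThan)
  have on: "orthonormal_family b ?d"
    unfolding orthonormal_family_def
  proof (intro allI impI)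
    fix i j assume ij: "i < ?d" "j < ?d"
    then have "b i \<in> Basis" "b j \<in> Basis"
      using b by (auto dest: bij_betwE)
    moreover have "b i = b j \<longleftrightarrow> i = j"
      using b ij by (auto simp: bij_betw_def inj_on_eq_iff)
    ultimately show "b i \<bullet> b j = (if i = j then 1 else 0)"
      by (simp add: inner_Basis)
  qed
  define v where "v i = (if i < 3 * k then triple_vec b i else b (i - k))" for i
  have "norm (v i) = 1" if "i < ?d + k" for i
  proof (cases "i < 3 * k")
    case True
    then show ?thesis
      using norm_triple_vec[OF on _ assms] by (simp add: v_def)
  next
    case False
    then have "i - k < ?d" using that by simp
    then show ?thesis
      using False orthonormal_familyD[OF on] by (simp add: v_def norm_eq_1)
  qed
  moreover have "(norm (\<Sum>i<?d + k. \<epsilon> i *\<^sub>R v i))\<^sup>2 \<le> real ?d + 2 * real k"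
    if \<epsilon>: "\<And>i. i < ?d + k \<Longrightarrow> \<epsilon> i \<in> {1, -1}" for \<epsilon>
  proof -
    define a where "a j = (if j < 2 * k then triple_coord \<epsilon> j else \<epsilon> (j + k))" for j
    have split: "sum f {..<m + r} = sum f {..<m} + (\<Sum>i<r. f (m + i))"
      for f :: "nat \<Rightarrow> 'c::comm_monoid_add" and m r
      by (induction r) (simp_all add: add.assoc)
    obtain r where r: "?d = 2 * k + r"
      using assms le_Suc_ex by blast
    have dk: "?d + k = 3 * k + r"
      using r by simp
    have "(\<Sum>i<?d + k. \<epsilon> i *\<^sub>R v i)
        = (\<Sum>i<3 * k. \<epsilon> i *\<^sub>R triple_vec b i) + (\<Sum>i<r. \<epsilon> (3 * k + i) *\<^sub>R b (2 * k + i))"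
      unfolding dk split by (simp add: v_def)
    also have "\<dots> = (\<Sum>j<?d. a j *\<^sub>R b j)"
      unfolding r split sum_triple_vec by (simp add: a_def algebra_simps)
    finally have "(norm (\<Sum>i<?d + k. \<epsilon> i *\<^sub>R v i))\<^sup>2 = (\<Sum>j<?d. (a j)\<^sup>2)"
      by (simp add: norm_square_sum_orthonormal[OF on])
    also have "\<dots> = (\<Sum>j<2 * k. (triple_coord \<epsilon> j)\<^sup>2) + (\<Sum>i<r. (a (2 * k + i))\<^sup>2)"
      unfolding r split by (simp add: a_def)
    also have "(\<Sum>i<r. (a (2 * k + i))\<^sup>2) = real r"
    proof -
      have "(a (2 * k + i))\<^sup>2 = 1" if "i < r" for i
        using \<epsilon>[of "2 * k + i + k"] that r by (auto simp: a_def)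
      then show ?thesis by simp
    qed
    also have "(\<Sum>j<2 * k. (triple_coord \<epsilon> j)\<^sup>2) \<le> 4 * real k"
      using \<epsilon> assms by (intro sum_triple_coord_squared_le) auto
    finally show ?thesis
      using r by simp
  qed
  ultimately show ?thesis by (rule that)
qed

theorem mainTheorem4:
  fixes n :: nat
  assumes "n \<in> {CARD('d::finite)..nat \<lfloor>3 * real CARD('d) / 2\<rfloor>}"
  shows "sign_sum_const TYPE(real ^ 'd) n = sqrt (2 * real n - real CARD('d))"
  unfolding sign_sum_const_def
proof (rule Greatest_equality)
  show "sign_sum_bound TYPE(real ^ 'd) n (sqrt (2 * real n - real CARD('d)))"
    unfolding sign_sum_bound_def
  proof (intro allI impI)
    fix v :: "nat \<Rightarrow> real ^ 'd" assume v: "\<forall>i<n. norm (v i) = 1"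
    obtain \<epsilon> :: "nat \<Rightarrow> real" where \<epsilon>: "\<And>i. i < n \<Longrightarrow> \<epsilon> i \<in> {1, -1}"
      and "2 * real n - real DIM(real ^ 'd) \<le> (norm (\<Sum>i<n. \<epsilon> i *\<^sub>R v i))\<^sup>2"
      using exists_large_sign_sum[of n v] v by metis
    then have "sqrt (2 * real n - real CARD('d)) \<le> norm (\<Sum>i<n. \<epsilon> i *\<^sub>R v i)"
      by (intro real_le_lsqrt) simp_all
    with \<epsilon> show "\<exists>\<epsilon>. (\<forall>i<n. \<epsilon> i \<in> {1, -1}) \<and>
        sqrt (2 * real n - real CARD('d)) \<le> norm (\<Sum>i<n. \<epsilon> i *\<^sub>R v i)"
      by blast
  qed
next
  fix c assume c: "sign_sum_bound TYPE(real ^ 'd) n c"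
  define k where "k = n - CARD('d)"
  have n: "n = CARD('d) + k"
    using assms by (simp add: k_def)
  have "real n \<le> 3 * real CARD('d) / 2"
    using assms by (simp add: le_nat_iff le_floor_iff)
  then have k: "2 * k \<le> DIM(real ^ 'd)"
    unfolding n by simp
  obtain v :: "nat \<Rightarrow> real ^ 'd" where v: "\<And>i. i < n \<Longrightarrow> norm (v i) = 1"
    and small: "\<And>\<epsilon>. (\<And>i. i < n \<Longrightarrow> \<epsilon> i \<in> {1, -1}) \<Longrightarrow>
       (norm (\<Sum>i<n. \<epsilon> i *\<^sub>R v i))\<^sup>2 \<le> real CARD('d) + 2 * real k"
    using exists_small_sign_sums[OF k] unfolding n by auto
  obtain \<epsilon> :: "nat \<Rightarrow> real" where \<epsilon>: "\<And>i. i < n \<Longrightarrow> \<epsilon> i \<in> {1, -1}"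
    "c \<le> norm (\<Sum>i<n. \<epsilon> i *\<^sub>R v i)"
    using c v unfolding sign_sum_bound_def by blast
  have "norm (\<Sum>i<n. \<epsilon> i *\<^sub>R v i) \<le> sqrt (real CARD('d) + 2 * real k)"
    using small[OF \<epsilon>(1)] by (rule real_le_rsqrt)
  with \<epsilon>(2) show "c \<le> sqrt (2 * real n - real CARD('d))"
    by (simp add: n)
qed

end
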